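(* Let $k, r, n$ be integers with $2 \le k < r < n$. Let $H$ be a $k$-uniform hypergraph on $n$ vertices and let $H^c$ be the $k$-uniform hypergraph with vertex set $V(H)$ and edge set $\binom{V(H)}{k} \setminus E(H)$. Then $H$ is a primitive uniquely $K_r^{(k)}$-saturated hypergraph if and only if $H^c$ is a uniquely $\tau$-critical hypergraph with no isolated vertices and $\tau(H^c) = n-r+1$.
   Context: $K_r^{(k)}$ denotes the complete $k$-uniform hypergraph on $r$ vertices. A $k$-uniform hypergraph $H$ is uniquely $K_r^{(k)}$-saturated if $H$ contains no copy of $K_r^{(k)}$ (i.e., no $r$-set of vertices all of whose $k$-subsets are edges), and for every $k$-subset $S$ of $V(H)$ that is not an edge of $H$, the hypergraph $H+S$ contains exactly one copy of $K_r^{(k)}$. A vertex $v$ is dominating in $H$ if every $k$-subset of $V(H)$ containing $v$ is an edge of $H$. $H$ is primitive uniquely $K_r^{(k)}$-saturated if it is uniquely $K_r^{(k)}$-saturated and has no dominating vertex. A transversal of a hypergraph $G$ is a vertex subset meeting every edge; $\tau(G)$ is the minimum size of a transversal. $G$ is $\tau$-critical if $\tau(G-e) < \tau(G)$ for every edge $e$. $G$ is uniquely $\tau$-critical if it is $\tau$-critical and for every edge $e$, the hypergraph $G-e$ has a unique minimum transversal. A vertex is isolated if it lies in no edge. *)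

theory Defs
  imports Main "HOL-Library.Ramsey"
begin

text \<open>
  A hypergraph is given by its vertex set \<open>V\<close> and its edge set \<open>E\<close>.
  The set of \<open>k\<close>-subsets of \<open>V\<close> is the library's \<^term>\<open>nsets V k\<close>. Hence adding an edge
  \<open>S\<close> is \<^term>\<open>insert S E\<close>, and deleting an edge \<open>e\<close> (keeping all vertices) is
  \<^term>\<open>E - {e}\<close>.
\<close>

definition uniform_hypergraph :: "nat \<Rightarrow> 'a set \<Rightarrow> 'a set set \<Rightarrow> bool" where
  "uniform_hypergraph k V E \<longleftrightarrow> finite V \<and> E \<subseteq> nsets V k"

definition complement_edges :: "nat \<Rightarrow> 'a set \<Rightarrow> 'a set set \<Rightarrow> 'a set set" where
  "complement_edges k V E = nsets V k - E"

text \<open>A copy of the complete \<open>k\<close>-uniform hypergraph on \<open>r\<close> vertices is identified with its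
  vertex set, which determines it.\<close>

definition complete_copies :: "nat \<Rightarrow> nat \<Rightarrow> 'a set \<Rightarrow> 'a set set \<Rightarrow> 'a set set" where
  "complete_copies k r V E = {R \<in> nsets V r. nsets R k \<subseteq> E}"

definition uniquely_saturated :: "nat \<Rightarrow> nat \<Rightarrow> 'a set \<Rightarrow> 'a set set \<Rightarrow> bool" where
  "uniquely_saturated k r V E \<longleftrightarrow>
     complete_copies k r V E = {} \<and>
     (\<forall>S \<in> nsets V k. S \<notin> E \<longrightarrow> (\<exists>!R. R \<in> complete_copies k r V (insert S E)))"

definition dominating_vertex :: "nat \<Rightarrow> 'a set \<Rightarrow> 'a set set \<Rightarrow> 'a \<Rightarrow> bool" where
  "dominating_vertex k V E v \<longleftrightarrow> v \<in> V \<and> (\<forall>S \<in> nsets V k. v \<in> S \<longrightarrow> S \<in> E)"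

definition primitive_uniquely_saturated :: "nat \<Rightarrow> nat \<Rightarrow> 'a set \<Rightarrow> 'a set set \<Rightarrow> bool" where
  "primitive_uniquely_saturated k r V E \<longleftrightarrow>
     uniquely_saturated k r V E \<and> \<not> (\<exists>v. dominating_vertex k V E v)"

definition transversal :: "'a set \<Rightarrow> 'a set set \<Rightarrow> 'a set \<Rightarrow> bool" where
  "transversal V E T \<longleftrightarrow> T \<subseteq> V \<and> (\<forall>e \<in> E. T \<inter> e \<noteq> {})"

text \<open>The minimum exists when \<open>V\<close> is finite and every edge is a nonempty subset of \<open>V\<close>,
  since then \<open>V\<close> itself is a transversal.\<close>

definition transversal_number :: "'a set \<Rightarrow> 'a set set \<Rightarrow> nat" where
  "transversal_number V E = (LEAST m. \<exists>T. transversal V E T \<and> card T = m)"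

definition minimum_transversal :: "'a set \<Rightarrow> 'a set set \<Rightarrow> 'a set \<Rightarrow> bool" where
  "minimum_transversal V E T \<longleftrightarrow> transversal V E T \<and> card T = transversal_number V E"

definition tau_critical :: "'a set \<Rightarrow> 'a set set \<Rightarrow> bool" where
  "tau_critical V E \<longleftrightarrow>
     (\<forall>e \<in> E. transversal_number V (E - {e}) < transversal_number V E)"

definition uniquely_tau_critical :: "'a set \<Rightarrow> 'a set set \<Rightarrow> bool" where
  "uniquely_tau_critical V E \<longleftrightarrow>
     tau_critical V E \<and> (\<forall>e \<in> E. \<exists>!T. minimum_transversal V (E - {e}) T)"

definition isolated_vertex :: "'a set \<Rightarrow> 'a set set \<Rightarrow> 'a \<Rightarrow> bool" where
  "isolated_vertex V E v \<longleftrightarrow> v \<in> V \<and> (\<forall>e \<in> E. v \<notin> e)"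

end

theory Submission imports Defs
begin

text \<open>
  The complement \<open>V - R\<close> of an \<open>r\<close>-set \<open>R\<close> is a transversal of \<open>H\<^sup>c\<close> iff \<open>R\<close> spans a copy of
  \<open>K\<^sub>r\<close> in \<open>H\<close>, and \<open>H + S\<close> corresponds to \<open>H\<^sup>c - S\<close>. So saturation says that \<open>H\<^sup>c\<close> has no
  transversal of size \<open>n - r\<close>, while deleting any edge creates exactly one. As deleting an
  edge lowers \<open>\<tau>\<close> by at most one, that transversal is the unique minimum one.
  Dominating vertices of \<open>H\<close> are isolated vertices of \<open>H\<^sup>c\<close>.
\<close>

lemma transversal_number_le:
  "transversal V E T \<Longrightarrow> transversal_number V E \<le> card T"
  unfolding transversal_number_def by (rule Least_le) blast

lemma minimum_transversal_exists:
  assumes "transversal V E T"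
  obtains T' where "minimum_transversal V E T'"
proof -
  have "\<exists>T'. transversal V E T' \<and> card T' = transversal_number V E"
    unfolding transversal_number_def by (rule LeastI_ex) (use assms in blast)
  then show thesis
    using that unfolding minimum_transversal_def by blast
qed

text \<open>Supersets of a transversal inside \<open>V\<close> are again transversals, so a small
  one can be padded. This lets the absence of transversals of size exactly \<open>m\<close> exclude
  all smaller ones too.\<close>

lemma transversal_extend_card:
  assumes "finite V" "transversal V E T" "card T \<le> m" "m \<le> card V"
  obtains T' where "transversal V E T'" "card T' = m"
proof -
  have "T \<subseteq> V"
    using assms(2) by (simp add: transversal_def)
  then obtain T' where "T \<subseteq> T'" "T' \<subseteq> V" "card T' = m"
    using exists_subset_between assms by metis
  moreover have "transversal V E T'"
    using assms(2) \<open>T \<subseteq> T'\<close> \<open>T' \<subseteq> V\<close> unfolding transversal_def by blast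
  ultimately show thesis
    using that by blast
qed

text \<open>Adding any one vertex of \<open>e\<close> to \<open>T\<close> repairs the only edge that
  \<open>T\<close> may miss.\<close>

lemma transversal_number_le_Suc_delete:
  assumes "e \<subseteq> V" "e \<noteq> {}" "transversal V (E - {e}) T"
  shows "transversal_number V E \<le> Suc (card T)"
proof -
  obtain x where "x \<in> e"
    using assms(2) by blast
  then have "transversal V E (insert x T)"
    using assms(1,3) unfolding transversal_def by blast
  then have "transversal_number V E \<le> card (insert x T)"
    by (rule transversal_number_le)
  also have "\<dots> \<le> Suc (card T)"
    by (rule card_insert_le_m1) auto
  finally show ?thesis .
qed

lemma complement_edges_insert:
  "complement_edges k V (insert S E) = complement_edges k V E - {S}"
  by (auto simp: complement_edges_def)

text \<open>The edges missed by \<open>V - R\<close> are exactly those lying inside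
  \<open>R\<close>.\<close>

lemma transversal_complement_edges_iff:
  assumes "R \<subseteq> V"
  shows "transversal V (complement_edges k V E) (V - R) \<longleftrightarrow> nsets R k \<subseteq> E"
proof -
  have "(V - R) \<inter> e = {} \<longleftrightarrow> e \<subseteq> R" if "e \<subseteq> V" for e
    using that by blast
  then have "transversal V (complement_edges k V E) (V - R) \<longleftrightarrow>
      (\<forall>e \<in> nsets V k - E. \<not> e \<subseteq> R)"
    by (auto simp: transversal_def complement_edges_def nsets_def)
  also have "\<dots> \<longleftrightarrow> nsets R k \<subseteq> E"
    using assms by (auto simp: nsets_def)
  finally show ?thesis .
qed

lemma bij_betw_complete_copies_transversals:
  assumes "finite V" "r \<le> card V"
  shows "bij_betw (\<lambda>R. V - R) (complete_copies k r V E)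
    {T. transversal V (complement_edges k V E) T \<and> card T = card V - r}"
proof (rule bij_betw_byWitness[where f' = "\<lambda>T. V - T"])
  show "(\<lambda>R. V - R) ` complete_copies k r V E
      \<subseteq> {T. transversal V (complement_edges k V E) T \<and> card T = card V - r}"
    using transversal_complement_edges_iff
    by (fastforce simp: complete_copies_def nsets_def card_Diff_subset)
  show "(\<lambda>T. V - T) ` {T. transversal V (complement_edges k V E) T \<and> card T = card V - r}
      \<subseteq> complete_copies k r V E"
  proof clarify
    fix T assume T: "transversal V (complement_edges k V E) T" "card T = card V - r"
    then have "T \<subseteq> V"
      by (simp add: transversal_def)
    \<comment> \<open>Here \<open>r \<le> card V\<close> matters: otherwise
      \<open>card V - r\<close> would truncate to 0.\<close>
    then have "card (V - T) = r" "V - (V - T) = T"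
      using T(2) assms by (auto simp: card_Diff_subset finite_subset)
    then show "V - T \<in> complete_copies k r V E"
      using T(1) assms(1) transversal_complement_edges_iff[of "V - T" V k E]
      by (simp add: complete_copies_def nsets_def)
  qed
qed (auto simp: complete_copies_def nsets_def transversal_def)

lemma bij_betw_ex1_iff:
  assumes "bij_betw f A B"
  shows "(\<exists>!x. x \<in> A) \<longleftrightarrow> (\<exists>!y. y \<in> B)"
proof -
  have "(\<exists>!y. y \<in> f ` A) \<longleftrightarrow> (\<exists>!x. x \<in> A)"
    using assms by (auto simp: bij_betw_def dest: inj_onD)
  then show ?thesis
    using assms by (simp add: bij_betw_def)
qed

lemma uniquely_saturated_iff_transversals:
  assumes "finite V" "r \<le> card V"
  shows "uniquely_saturated k r V E \<longleftrightarrow>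
    (\<nexists>T. transversal V (complement_edges k V E) T \<and> card T = card V - r) \<and>
    (\<forall>S \<in> complement_edges k V E.
      \<exists>!T. transversal V (complement_edges k V E - {S}) T \<and> card T = card V - r)"
proof -
  have "complete_copies k r V E = {} \<longleftrightarrow>
      (\<nexists>T. transversal V (complement_edges k V E) T \<and> card T = card V - r)"
    using bij_betw_complete_copies_transversals[OF assms, of k E]
    by (auto simp: bij_betw_def)
  moreover have "(\<exists>!R. R \<in> complete_copies k r V (insert S E)) \<longleftrightarrow>
      (\<exists>!T. transversal V (complement_edges k V E - {S}) T \<and> card T = card V - r)" for S
    using bij_betw_ex1_iff[OF bij_betw_complete_copies_transversals[OF assms, of k "insert S E"]]
    by (simp add: complement_edges_insert)
  moreover have "S \<in> complement_edges k V E \<longleftrightarrow> S \<in> nsets V k \<and> S \<notin> E" for S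
    by (simp add: complement_edges_def)
  ultimately show ?thesis
    by (simp add: uniquely_saturated_def Ball_def imp_conjL)
qed

text \<open>In either direction each \<open>E - {e}\<close> turns out to have transversal number
  exactly \<open>m\<close>, so its transversals of size \<open>m\<close> are its minimum
  transversals and the two uniqueness conditions coincide.\<close>

lemma unique_transversal_on_deletion_iff:
  assumes "finite V" "m < card V" "\<And>e. e \<in> E \<Longrightarrow> e \<subseteq> V \<and> e \<noteq> {}"
  shows "(\<nexists>T. transversal V E T \<and> card T = m) \<and>
      (\<forall>e \<in> E. \<exists>!T. transversal V (E - {e}) T \<and> card T = m) \<longleftrightarrow>
    uniquely_tau_critical V E \<and> transversal_number V E = m + 1"
proof -
  have V: "transversal V E V" "\<And>e. transversal V (E - {e}) V"
    using assms(3) by (auto simp: transversal_def)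
  \<comment> \<open>If the transversal number were at most \<open>m\<close>, a minimum transversal
    could be padded to size \<open>m\<close>.\<close>
  have no_m: "(\<nexists>T. transversal V E T \<and> card T = m) \<longleftrightarrow> m < transversal_number V E"
  proof -
    obtain T where T: "transversal V E T" "card T = transversal_number V E"
      using minimum_transversal_exists[OF V(1)] by (auto simp: minimum_transversal_def)
    show ?thesis
      using T transversal_extend_card[OF assms(1) T(1), of m] assms(2)
        transversal_number_le[of V E]
      by (metis less_imp_le_nat not_le)
  qed
  have le_Suc: "transversal_number V E \<le> Suc (transversal_number V (E - {e}))" if "e \<in> E" for e
    using minimum_transversal_exists[OF V(2)[of e]] transversal_number_le_Suc_delete[of e V E]
      assms(3)[OF that]
    by (metis minimum_transversal_def)
  show ?thesis
  proof
    assume L: "(\<nexists>T. transversal V E T \<and> card T = m) \<and>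
      (\<forall>e \<in> E. \<exists>!T. transversal V (E - {e}) T \<and> card T = m)"
    have gt: "m < transversal_number V E"
      using no_m conjunct1[OF L] by (rule iffD1)
    have tau_delete: "transversal_number V (E - {e}) = m" if e: "e \<in> E" for e
    proof -
      obtain T where "transversal V (E - {e}) T" "card T = m"
        using bspec[OF conjunct2[OF L] e] by blast
      then have "transversal_number V (E - {e}) \<le> m"
        using transversal_number_le by metis
      then show ?thesis
        using gt le_Suc[OF e] by linarith
    qed
    \<comment> \<open>The upper bound \<open>m + 1\<close> comes from deleting some edge, so one has
      to exist.\<close>
    have "E \<noteq> {}"
    proof
      assume "E = {}"
      then have "transversal V E {}"
        by (simp add: transversal_def)
      then show False
        using gt transversal_number_le[of V E "{}"] by simp
    qed
    then obtain e where "e \<in> E"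
      by blast
    then have "transversal_number V E = m + 1"
      using gt le_Suc[of e] tau_delete[of e] by simp
    then show "uniquely_tau_critical V E \<and> transversal_number V E = m + 1"
      using L tau_delete
      by (simp add: uniquely_tau_critical_def tau_critical_def minimum_transversal_def)
  next
    assume R: "uniquely_tau_critical V E \<and> transversal_number V E = m + 1"
    \<comment> \<open>Criticality gives at most \<open>m\<close>, and \<open>le_Suc\<close> gives at
      least \<open>m\<close>.\<close>
    have "transversal_number V (E - {e}) = m" if "e \<in> E" for e
      using R le_Suc[OF that] that
      by (fastforce simp: uniquely_tau_critical_def tau_critical_def)
    then show "(\<nexists>T. transversal V E T \<and> card T = m) \<and>
      (\<forall>e \<in> E. \<exists>!T. transversal V (E - {e}) T \<and> card T = m)"
      using R no_m by (simp add: uniquely_tau_critical_def minimum_transversal_def)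
  qed
qed

lemma dominating_vertex_iff_isolated_vertex:
  "dominating_vertex k V E v \<longleftrightarrow> isolated_vertex V (complement_edges k V E) v"
  by (auto simp: dominating_vertex_def isolated_vertex_def complement_edges_def)

theorem theorem3:
  fixes k r n :: nat and V :: "'a set" and E :: "'a set set"
  assumes "2 \<le> k" and "k < r" and "r < n"
    and "uniform_hypergraph k V E" and "card V = n"
  shows "primitive_uniquely_saturated k r V E \<longleftrightarrow>
    (uniquely_tau_critical V (complement_edges k V E) \<and>
     \<not> (\<exists>v. isolated_vertex V (complement_edges k V E) v) \<and>
     transversal_number V (complement_edges k V E) = n - r + 1)"
proof -
  have "finite V"
    using assms(4) by (simp add: uniform_hypergraph_def)
  \<comment> \<open>Edges are nonempty because \<open>k\<close> is positive.\<close>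
  moreover have "e \<subseteq> V \<and> e \<noteq> {}" if "e \<in> complement_edges k V E" for e
    using that assms(1) by (auto simp: complement_edges_def nsets_def)
  \<comment> \<open>The size is \<open>m = n - r\<close>; \<open>m < card V\<close> holds because
    \<open>k < r\<close> makes \<open>r\<close> positive.\<close>
  ultimately have "uniquely_saturated k r V E \<longleftrightarrow>
      uniquely_tau_critical V (complement_edges k V E) \<and>
      transversal_number V (complement_edges k V E) = n - r + 1"
    using uniquely_saturated_iff_transversals[of V r k E]
      unique_transversal_on_deletion_iff[of V "n - r" "complement_edges k V E"] assms
    by simp
  then show ?thesis
    by (auto simp: primitive_uniquely_saturated_def dominating_vertex_iff_isolated_vertex)
qed

end
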